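(* Let $c:[0,\infty)\to\mathbb{R}$ be continuous and strictly increasing and let $\epsilon\in(0,1)$. For $\lambda>0$ let $F_\lambda$ be the problem $\min_{\beta\ge0} c(\beta)$ subject to $\tilde\alpha(\beta,\lambda)\le\epsilon$, and let $G_\lambda$ be the problem $\min_{\beta\ge0} c(\beta)$ subject to $UB(\beta,\lambda)\le\epsilon$. Then for every $\lambda>0$ both problems have (unique) optimal solutions $\beta^F_\lambda$ and $\beta^G_\lambda$, these satisfy $\beta^G_\lambda\ge\beta^F_\lambda$, and there is a finite $\beta^*$ with $$\lim_{\lambda\to\infty}\beta^G_\lambda=\lim_{\lambda\to\infty}\beta^F_\lambda=\beta^*.$$
   Context: $\phi,\Phi$ are the standard normal density and distribution function. For $\lambda>0$ and real $n\ge 0$, $\bar\alpha(n,\lambda)=\min\Big\{1,\big[\lambda\int_0^\infty t e^{-\lambda t}(1+t)^{n-1}\,dt\big]^{-1}\Big\}$ is the continuous Erlang-C function, and $\tilde\alpha(\beta,\lambda)=\bar\alpha(\lambda+\beta\sqrt\lambda,\lambda)$. For $\lambda>0,\beta\ge 0$ set $n=\lambda+\beta\sqrt{\lambda}$, $\rho=\lambda/n$, $a=\sqrt{-2n(1-\rho+\ln\rho)}$, $\gamma=(n-\lambda)/\sqrt{n}$, and $UB(\beta,\lambda)=\left[\rho+\gamma\left(\frac{\Phi(a)}{\phi(a)}+\frac{2}{3\sqrt{n}}\right)\right]^{-1}$. It is known (Janssen, van Leeuwaarden and Zwart) that $\tilde\alpha(\beta,\lambda)\le UB(\beta,\lambda)$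 for all $\lambda,\beta>0$. *)

theory Defs
  imports "HOL-Analysis.Analysis"
begin

definition std_phi :: "real \<Rightarrow> real" where
  "std_phi x = exp (- (x ^ 2) / 2) / sqrt (2 * pi)"

definition std_Phi :: "real \<Rightarrow> real" where
  "std_Phi x = (LBINT t:{..x}. std_phi t)"

definition erlang_c :: "real \<Rightarrow> real \<Rightarrow> real" where
  "erlang_c n lam = min 1 (inverse (lam * (LBINT t:{0..}. t * exp (- lam * t) * (1 + t) powr (n - 1))))"

definition alpha_tilde :: "real \<Rightarrow> real \<Rightarrow> real" where
  "alpha_tilde \<beta> lam = erlang_c (lam + \<beta> * sqrt lam) lam"

definition UB :: "real \<Rightarrow> real \<Rightarrow> real" where
  "UB \<beta> lam =
    (let n = lam + \<beta> * sqrt lam;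
         \<rho> = lam / n;
         a = sqrt (- 2 * n * (1 - \<rho> + ln \<rho>));
         \<gamma> = (n - lam) / sqrt n
     in inverse (\<rho> + \<gamma> * (std_Phi a / std_phi a + 2 / (3 * sqrt n))))"

definition is_opt :: "(real \<Rightarrow> bool) \<Rightarrow> (real \<Rightarrow> real) \<Rightarrow> real \<Rightarrow> bool" where
  "is_opt P c \<beta> \<longleftrightarrow> \<beta> \<ge> 0 \<and> P \<beta> \<and> (\<forall>\<beta>'. \<beta>' \<ge> 0 \<and> P \<beta>' \<longrightarrow> c \<beta> \<le> c \<beta>')"

definition betaF :: "(real \<Rightarrow> real) \<Rightarrow> real \<Rightarrow> real \<Rightarrow> real" where
  "betaF c \<epsilon> lam = (THE \<beta>. is_opt (\<lambda>b. alpha_tilde b lam \<le> \<epsilon>) c \<beta>)"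

definition betaG :: "(real \<Rightarrow> real) \<Rightarrow> real \<Rightarrow> real \<Rightarrow> real" where
  "betaG c \<epsilon> lam = (THE \<beta>. is_opt (\<lambda>b. UB b lam \<le> \<epsilon>) c \<beta>)"

end

theory Submission
  imports Defs "HOL-Probability.Probability" "HOL-Real_Asymp.Real_Asymp"
begin

text \<open>
  Write \<open>n = l + b * sqrt l\<close> and \<open>J = \<integral>\<^sub>0\<^sup>\<infinity> exp (- l * t) * (1 + t) powr (n - 1) dt\<close>.
  Integration by parts turns the reciprocal of the Erlang-C function into \<open>1 + (n - l) * J\<close>, and \<open>J\<close> is
  compared with Gaussian integrals from both sides by exhibiting primitives in terms of \<open>\<Phi>\<close>.

  From above: with \<open>u = ln (1 + t)\<close> the inequality \<open>t \<ge> u + u\<^sup>2 / 2\<close> gives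
  \<open>sqrt l * J \<le> \<Phi>(b) / \<phi>(b)\<close>, so for every \<open>l\<close> the reciprocal of the Erlang-C function is at most
  \<open>1 + b * \<Phi>(b) / \<phi>(b)\<close>, the reciprocal of the Halfin-Whitt limit.

  From below: with \<open>x = (l / n) * (1 + t)\<close> and \<open>y\<^sup>2 / 2 = x - 1 - ln x\<close> (where \<open>y\<close> has the sign of
  \<open>x - 1\<close>), one has \<open>dx / x \<ge> (1 - y / 3) dy\<close>, and integrating this against \<open>exp (- n * y\<^sup>2 / 2)\<close>
  gives exactly the Janssen--van Leeuwaarden--Zwart bound.

  Let \<open>s\<close> be the point where the Halfin-Whitt function equals \<open>\<epsilon>\<close>. The two comparisons give
  \<open>s \<le> \<beta>\<^sup>F \<le> \<beta>\<^sup>G\<close> for every \<open>l\<close>, so only pointwise convergence of the bound is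
  needed for both limits.
\<close>

section \<open>The standard normal density and distribution function\<close>

lemma std_phi_pos: "0 < std_phi x"
  by (simp add: std_phi_def)

lemma std_phi_minus [simp]: "std_phi (- x) = std_phi x"
  by (simp add: std_phi_def)

lemma std_phi_eq: "std_phi = std_normal_density"
  by (auto simp: std_phi_def std_normal_density_def fun_eq_iff)

lemma continuous_on_std_phi [continuous_intros]:
  "continuous_on S f \<Longrightarrow> continuous_on S (\<lambda>x. std_phi (f x))"
  unfolding std_phi_def by (intro continuous_intros) auto

lemma std_phi_measurable [measurable]: "std_phi \<in> borel_measurable borel"
  by (simp add: std_phi_eq)

lemma integrable_std_phi: "integrable lborel std_phi"
  by (simp add: std_phi_eq)

lemma set_integrable_std_phi: "S \<in> sets lborel \<Longrightarrow> set_integrable lborel S std_phi"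
  using set_integrable_subset[OF _ _ subset_UNIV, of lborel std_phi S] integrable_std_phi
  by (simp add: set_integrable_def)

lemma std_phi_antimono: "0 \<le> x \<Longrightarrow> x \<le> y \<Longrightarrow> std_phi y \<le> std_phi x"
  by (auto simp: std_phi_def divide_right_mono)

text \<open>Transfers monotonicity, nonnegativity and the limit at infinity from the general theory
  of distribution functions.\<close>

lemma std_Phi_eq_cdf: "std_Phi x = cdf std_normal_distribution x"
proof -
  have "emeasure std_normal_distribution {..x} = (\<integral>\<^sup>+t. ennreal (indicator {..x} t * std_phi t) \<partial>lborel)"
    by (subst emeasure_density) (auto simp: std_phi_eq ennreal_mult'' intro!: nn_integral_cong split: split_indicator)
  also have "\<dots> = ennreal (std_Phi x)"
    unfolding std_Phi_def set_lebesgue_integral_def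
    using set_integrable_std_phi[of "{..x}"]
    by (subst nn_integral_eq_integral) (auto simp: set_integrable_def less_imp_le[OF std_phi_pos])
  finally show ?thesis
    unfolding cdf_def measure_def std_Phi_def
    by (simp add: set_lebesgue_integral_def integral_nonneg less_imp_le[OF std_phi_pos])
qed

interpretation std_normal: real_distribution std_normal_distribution
  by (rule real_dist_normal_dist)

lemma std_Phi_mono: "x \<le> y \<Longrightarrow> std_Phi x \<le> std_Phi y"
  by (simp add: std_Phi_eq_cdf std_normal.cdf_nondecreasing)

lemma std_Phi_nonneg: "0 \<le> std_Phi x"
  by (simp add: std_Phi_eq_cdf std_normal.cdf_nonneg)

lemma std_Phi_at_top: "(std_Phi \<longlongrightarrow> 1) at_top"
  using std_normal.cdf_lim_at_top_prob by (simp add: std_Phi_eq_cdf[abs_def])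

lemma std_Phi_minus: "std_Phi (- x) = 1 - std_Phi x"
proof -
  have "std_Phi (- x) = (LBINT t:{x..}. std_phi t)"
    unfolding std_Phi_def by (subst set_integral_reflect) (simp add: atLeast_def)
  also have "\<dots> = (LBINT t:{x<..}. std_phi t)"
    using set_integrable_std_phi AE_lborel_singleton[of x]
    by (intro set_integral_cong_set) (auto simp: set_borel_measurable_def)
  also have "std_Phi x + (LBINT t:{x<..}. std_phi t) = (LBINT t:{..x} \<union> {x<..}. std_phi t)"
    unfolding std_Phi_def by (intro set_integral_Un[symmetric] set_integrable_std_phi) auto
  also have "{..x} \<union> {x<..} = UNIV" by auto
  also have "(LBINT t:UNIV. std_phi t) = 1"
    by (simp add: set_lebesgue_integral_def std_phi_eq)
  finally show ?thesis by linarith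
qed

text \<open>Near \<open>x\<close> the mass of \<open>{..x - 1}\<close> is a constant; what remains
  is an integral over a compact interval, covered by the fundamental theorem of calculus.\<close>

lemma DERIV_std_Phi: "(std_Phi has_real_derivative std_phi x) (at x)"
proof -
  let ?g = "\<lambda>y. std_Phi (x - 1) + integral {x - 1..y} std_phi"
  have eq: "?g y = std_Phi y" if "y \<in> {x-1<..<x+1}" for y
  proof -
    have "std_Phi y = (LBINT t:{..x-1} \<union> {x-1<..y}. std_phi t)"
      unfolding std_Phi_def using that by (intro arg_cong2[where f="set_lebesgue_integral lborel"]) auto
    also have "\<dots> = std_Phi (x - 1) + (LBINT t:{x-1<..y}. std_phi t)"
      unfolding std_Phi_def by (intro set_integral_Un set_integrable_std_phi) auto
    also have "(LBINT t:{x-1<..y}. std_phi t) = (LBINT t:{x-1..y}. std_phi t)"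
      using AE_lborel_singleton[of "x-1"]
      by (intro set_integral_cong_set) (auto simp: set_borel_measurable_def)
    also have "\<dots> = integral {x-1..y} std_phi"
      by (intro set_borel_integral_eq_integral set_integrable_std_phi) auto
    finally show ?thesis by simp
  qed
  have "((\<lambda>y. integral {x-1..y} std_phi) has_real_derivative std_phi x) (at x within {x-1..x+1})"
    by (intro integral_has_real_derivative continuous_intros) auto
  hence "((\<lambda>y. integral {x-1..y} std_phi) has_real_derivative std_phi x) (at x)"
    by (subst (asm) at_within_Icc_at) auto
  hence "(?g has_real_derivative std_phi x) (at x)"
    by (auto intro!: derivative_eq_intros)
  thus ?thesis
    by (rule has_field_derivative_transform_within_open[where S="{x-1<..<x+1}"]) (auto simp: eq)
qed

lemma isCont_std_Phi: "isCont std_Phi x"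
  using DERIV_std_Phi by (rule DERIV_isCont)

lemma continuous_on_std_Phi [continuous_intros]:
  "continuous_on S f \<Longrightarrow> continuous_on S (\<lambda>x. std_Phi (f x))"
  by (rule continuous_on_compose2[of UNIV std_Phi])
    (auto intro: continuous_at_imp_continuous_on isCont_std_Phi)

lemma std_Phi_pos: "0 \<le> x \<Longrightarrow> 0 < std_Phi x"
  using std_Phi_mono[of 0 x] std_Phi_minus[of 0] by simp

section \<open>Bounding half-line integrals by primitives\<close>

lemma set_integral_FTC_bound_above:
  fixes f p P :: "real \<Rightarrow> real"
  assumes [measurable]: "f \<in> borel_measurable borel" "p \<in> borel_measurable borel"
    and P: "\<And>t. 0 \<le> t \<Longrightarrow> (P has_real_derivative p t) (at t)"
    and fp: "\<And>t. 0 \<le> t \<Longrightarrow> 0 \<le> f t" "\<And>t. 0 \<le> t \<Longrightarrow> f t \<le> p t"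
    and L: "(P \<longlongrightarrow> L) at_top"
  shows "set_integrable lborel {0..} f" "(LBINT t:{0..}. f t) \<le> L - P 0"
proof -
  have p0: "0 \<le> p t" if "0 \<le> t" for t using fp[OF that] by linarith
  \<comment> \<open>As \<open>p\<close> is nonnegative, its primitive gives the integral before
    integrability is known; integrability of \<open>f\<close> follows by domination.\<close>
  have nn: "(\<integral>\<^sup>+t. ennreal (p t) * indicator {0..} t \<partial>lborel) = ennreal (L - P 0)"
    by (rule nn_integral_FTC_atLeast[OF _ P p0 L]) simp_all
  have mono: "P 0 \<le> P t" if "0 \<le> t" for t
    by (rule DERIV_nonneg_imp_nondecreasing[OF that]) (metis P p0)
  have "P 0 \<le> L"
    by (rule tendsto_lowerbound[OF L eventually_mono[OF eventually_ge_at_top[of 0]] trivial_limit_at_top_linorder])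
      (rule mono)
  hence "has_bochner_integral lborel (\<lambda>t. indicator {0..} t *\<^sub>R p t) (L - P 0)"
  proof (intro has_bochner_integral_nn_integral)
    have "(\<integral>\<^sup>+t. ennreal (indicator {0..} t *\<^sub>R p t) \<partial>lborel)
        = (\<integral>\<^sup>+t. ennreal (p t) * indicator {0..} t \<partial>lborel)"
      by (intro nn_integral_cong) (simp split: split_indicator)
    thus "(\<integral>\<^sup>+t. ennreal (indicator {0..} t *\<^sub>R p t) \<partial>lborel) = ennreal (L - P 0)"
      using nn by simp
  qed (auto simp: p0 split: split_indicator)
  hence p: "set_integrable lborel {0..} p" "(LBINT t:{0..}. p t) = L - P 0"
    by (auto simp: set_integrable_def set_lebesgue_integral_def has_bochner_integral_iff)
  show f: "set_integrable lborel {0..} f"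
  proof (rule set_integrable_bound[OF p(1)])
    show "set_borel_measurable lborel {0..} f"
      by (simp add: set_borel_measurable_def)
    show "AE t in lborel. t \<in> {0..} \<longrightarrow> norm (f t) \<le> norm (p t)"
      using fp p0 by simp
  qed
  show "(LBINT t:{0..}. f t) \<le> L - P 0"
    using set_integral_mono[OF f p(1)] fp p by simp
qed

text \<open>Here \<open>q\<close> may change sign, so the comparison is made on
  \<open>{0..T}\<close> and \<open>T\<close> is sent to infinity. The exceptional set
  \<open>S\<close> admits primitives that are merely continuous at finitely many points.\<close>

lemma set_integral_FTC_bound_below:
  fixes f q Q :: "real \<Rightarrow> real"
  assumes f: "set_integrable lborel {0..} f" and S: "finite S"
    and Q: "\<And>t. 0 < t \<Longrightarrow> t \<notin> S \<Longrightarrow> (Q has_real_derivative q t) (at t)"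
    and cont: "continuous_on {0..} Q"
    and qf: "\<And>t. 0 < t \<Longrightarrow> t \<notin> S \<Longrightarrow> q t \<le> f t"
    and L: "(Q \<longlongrightarrow> L) at_top"
  shows "L - Q 0 \<le> (LBINT t:{0..}. f t)"
proof (rule tendsto_le[OF trivial_limit_at_top_linorder])
  show "((\<lambda>T. LBINT t:{0..T}. f t) \<longlongrightarrow> (LBINT t:{0..}. f t)) at_top"
    using f by (intro tendsto_set_lebesgue_integral_at_top) auto
  show "((\<lambda>T. Q T - Q 0) \<longlongrightarrow> L - Q 0) at_top"
    by (intro tendsto_intros L)
  have "Q T - Q 0 \<le> (LBINT t:{0..T}. f t)" if "0 \<le> T" for T
  proof -
    \<comment> \<open>Setting the exceptional values, including the one at 0, to \<open>f t\<close>
      makes the comparison with \<open>f\<close> hold at every point of the interval.\<close>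
    define q' where "q' t = (if 0 < t \<and> t \<notin> S then q t else f t)" for t
    have fT: "set_integrable lborel {0..T} f"
      by (rule set_integrable_subset[OF f]) auto
    have q': "(q' has_integral Q T - Q 0) {0..T}"
    proof (rule fundamental_theorem_of_calculus_interior_strong[OF S that])
      show "(Q has_vector_derivative q' t) (at t)" if "t \<in> {0<..<T} - S" for t
        using that Q[of t] by (auto simp: q'_def has_real_derivative_iff_has_vector_derivative)
      show "continuous_on {0..T} Q" by (rule continuous_on_subset[OF cont]) auto
    qed
    have "(f has_integral (LBINT t:{0..T}. f t)) {0..T}"
      using set_borel_integral_eq_integral[OF fT] by (metis integrable_integral)
    from q' this show ?thesis
      by (rule has_integral_le) (use qf in \<open>simp add: q'_def\<close>)
  qed
  thus "\<forall>\<^sub>F T in at_top. Q T - Q 0 \<le> (LBINT t:{0..T}. f t)"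
    by (rule eventually_mono[OF eventually_ge_at_top[of 0]])
qed

text \<open>Two applications of the lower bound, to \<open>F\<close> and to its negative, which also
  handles integrands of varying sign.\<close>

lemma set_integral_FTC_atLeast:
  fixes f F :: "real \<Rightarrow> real"
  assumes f: "set_integrable lborel {0..} f"
    and F: "\<And>t. 0 \<le> t \<Longrightarrow> (F has_real_derivative f t) (at t)"
    and L: "(F \<longlongrightarrow> L) at_top"
  shows "(LBINT t:{0..}. f t) = L - F 0"
proof (rule antisym)
  have cont: "continuous_on {0..} F"
    by (rule DERIV_continuous_on) (use F in \<open>auto intro: has_field_derivative_at_within\<close>)
  show "L - F 0 \<le> (LBINT t:{0..}. f t)"
    using F by (intro set_integral_FTC_bound_below[OF f finite.emptyI, of F f] cont L) auto
  have "- L - (- F 0) \<le> (LBINT t:{0..}. - f t)"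
  proof (rule set_integral_FTC_bound_below[where S="{}" and q="\<lambda>t. - f t"])
    show "set_integrable lborel {0..} (\<lambda>t. - f t)"
      using f by (simp add: set_integrable_def)
    show "((\<lambda>t. - F t) has_real_derivative - f t) (at t)" if "0 < t" for t
      using F[of t] that by (intro DERIV_minus) auto
  qed (use cont L in \<open>auto intro: continuous_on_minus tendsto_minus\<close>)
  moreover have "(LBINT t:{0..}. - f t) = - (LBINT t:{0..}. f t)"
    by (simp add: set_lebesgue_integral_def)
  ultimately show "(LBINT t:{0..}. f t) \<le> L - F 0" by linarith
qed

section \<open>The Erlang integral, its Gaussian upper bound and the Erlang-C function\<close>

definition erlang_kernel :: "real \<Rightarrow> real \<Rightarrow> real \<Rightarrow> real" where
  "erlang_kernel n l t = exp (- l * t) * (1 + t) powr (n - 1)"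

definition erlang_J :: "real \<Rightarrow> real \<Rightarrow> real" where
  "erlang_J n l = (LBINT t:{0..}. erlang_kernel n l t)"

text \<open>By symmetry this is the classical Mills ratio, upper tail over density, at
  \<open>- x\<close>.\<close>

definition mills :: "real \<Rightarrow> real" where
  "mills x = std_Phi x / std_phi x"

lemma erlang_kernel_measurable [measurable]: "erlang_kernel n l \<in> borel_measurable borel"
  unfolding erlang_kernel_def by measurable

lemma erlang_kernel_nonneg: "0 \<le> erlang_kernel n l t"
  by (simp add: erlang_kernel_def)

lemma erlang_J_nonneg: "0 \<le> erlang_J n l"
  unfolding erlang_J_def set_lebesgue_integral_def
  by (intro Bochner_Integration.integral_nonneg) (auto simp: erlang_kernel_nonneg)

lemma std_phi_divide: "std_phi x / std_phi y = exp (y\<^sup>2 / 2 - x\<^sup>2 / 2)"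
proof -
  have "std_phi x / std_phi y = exp (- x\<^sup>2 / 2) / exp (- y\<^sup>2 / 2)"
    by (simp add: std_phi_def)
  thus ?thesis by (simp flip: exp_diff)
qed

text \<open>After the Taylor bound the exponent is quadratic in \<open>ln (1 + t)\<close>, and
  completing the square gives the Gaussian. The leftover factor \<open>1 / (1 + t)\<close> is the
  derivative of \<open>ln (1 + t)\<close>, so the majorant has an explicit primitive.\<close>

lemma erlang_kernel_le:
  assumes l: "0 < l" and t: "0 \<le> t"
  shows "erlang_kernel (l + b * sqrt l) l t
    \<le> std_phi (sqrt l * ln (1 + t) - b) / std_phi b / (1 + t)"
proof -
  define L where "L = ln (1 + t)"
  have L: "0 \<le> L" "exp L = 1 + t"
    using t by (auto simp: L_def)
  have "L + L\<^sup>2 / 2 \<le> t"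
    using exp_lower_Taylor_quadratic[OF L(1)] L(2) by simp
  hence "l * (L + L\<^sup>2 / 2) \<le> l * t"
    using l by (intro mult_left_mono) auto
  hence *: "- l * t + (l + b * sqrt l - 1) * L \<le> - ((sqrt l * L - b)\<^sup>2) / 2 + b\<^sup>2 / 2 - L"
    using l by (simp add: power2_diff power_mult_distrib algebra_simps add_divide_distrib diff_divide_distrib)
  have "erlang_kernel (l + b * sqrt l) l t = exp (- l * t + (l + b * sqrt l - 1) * L)"
    using t by (simp add: erlang_kernel_def powr_def L_def flip: exp_add)
  also have "\<dots> \<le> exp (b\<^sup>2 / 2 - (sqrt l * L - b)\<^sup>2 / 2 - L)"
    using * by simp
  also have "\<dots> = std_phi (sqrt l * L - b) / std_phi b / (1 + t)"
    using L(2) by (simp add: std_phi_divide exp_diff)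
  finally show ?thesis by (simp add: L_def)
qed

lemma
  assumes l: "0 < l"
  shows set_integrable_erlang_kernel_aux: "set_integrable lborel {0..} (erlang_kernel (l + b * sqrt l) l)"
    and erlang_J_le: "erlang_J (l + b * sqrt l) l \<le> mills b / sqrt l"
proof -
  let ?P = "\<lambda>t. std_Phi (sqrt l * ln (1 + t) - b) / (std_phi b * sqrt l)"
  let ?p = "\<lambda>t. std_phi (sqrt l * ln (1 + t) - b) / std_phi b / (1 + t)"
  have deriv: "(?P has_real_derivative ?p t) (at t)" if "0 \<le> t" for t
  proof -
    have "((\<lambda>t. sqrt l * ln (1 + t) - b) has_real_derivative sqrt l / (1 + t)) (at t)"
      using that by (auto intro!: derivative_eq_intros)
    from DERIV_cdivide[OF DERIV_chain2[OF DERIV_std_Phi this], of "std_phi b * sqrt l"]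
    show ?thesis using l by (simp add: mult.commute)
  qed
  have "filterlim (\<lambda>t. sqrt l * ln (1 + t) - b) at_top at_top"
    using l by real_asymp
  hence lim: "(?P \<longlongrightarrow> 1 / (std_phi b * sqrt l)) at_top"
    by (intro tendsto_divide filterlim_compose[OF std_Phi_at_top] tendsto_const)
      (use l std_phi_pos[of b] in auto)
  note * = set_integral_FTC_bound_above[OF _ _ deriv erlang_kernel_nonneg erlang_kernel_le[OF l] lim]
  show "set_integrable lborel {0..} (erlang_kernel (l + b * sqrt l) l)"
    by (rule *) measurable
  have "erlang_J (l + b * sqrt l) l \<le> 1 / (std_phi b * sqrt l) - ?P 0"
    unfolding erlang_J_def by (rule *) measurable
  \<comment> \<open>At 0 the primitive contains \<open>std_Phi (- b)\<close>, and its complement to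
    1 is \<open>std_Phi b\<close>.\<close>
  also have "\<dots> = mills b / sqrt l"
    using l std_phi_pos[of b] by (simp add: std_Phi_minus mills_def field_simps)
  finally show "erlang_J (l + b * sqrt l) l \<le> mills b / sqrt l" .
qed

text \<open>Every real \<open>n\<close> has the form \<open>l + b * sqrt l\<close> once
  \<open>b\<close> may be negative.\<close>

lemma set_integrable_erlang_kernel:
  assumes "0 < l"
  shows "set_integrable lborel {0..} (erlang_kernel n l)"
  using set_integrable_erlang_kernel_aux[OF assms, of "(n - l) / sqrt l"] assms by simp

text \<open>Integration by parts: both kernels arise from differentiating
  \<open>exp (- l * t) * (1 + t) powr n\<close>.\<close>

lemma erlang_J_recurrence:
  assumes l: "0 < l"
  shows "l * erlang_J (n + 1) l = 1 + n * erlang_J n l"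
proof -
  let ?F = "\<lambda>t. - (exp (- l * t) * (1 + t) powr n)"
  let ?f = "\<lambda>t. l * erlang_kernel (n + 1) l t - n * erlang_kernel n l t"
  have int: "set_integrable lborel {0..} (\<lambda>t. l * erlang_kernel (n + 1) l t)"
    "set_integrable lborel {0..} (\<lambda>t. n * erlang_kernel n l t)"
    using set_integrable_erlang_kernel[OF l] by auto
  have "(LBINT t:{0..}. ?f t) = 0 - ?F 0"
  proof (rule set_integral_FTC_atLeast)
    show "set_integrable lborel {0..} ?f" by (rule set_integral_diff(1)[OF int])
    show "(?F has_real_derivative ?f t) (at t)" if "0 \<le> t" for t
      using that by (auto intro!: derivative_eq_intros simp: erlang_kernel_def powr_diff field_simps)
    show "(?F \<longlongrightarrow> 0) at_top" using l by real_asymp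
  qed
  moreover have "(LBINT t:{0..}. ?f t) = l * erlang_J (n + 1) l - n * erlang_J n l"
    unfolding erlang_J_def by (subst set_integral_diff(2)[OF int]) simp
  ultimately show ?thesis by simp
qed

text \<open>Writing \<open>t\<close> as \<open>(1 + t) - 1\<close> splits the defining integral into
  two Erlang integrals, and the recurrence eliminates the one at \<open>n + 1\<close>.\<close>

lemma erlang_c_eq:
  assumes l: "0 < l"
  shows "erlang_c n l = min 1 (inverse (1 + (n - l) * erlang_J n l))"
proof -
  have "(LBINT t:{0..}. t * exp (- l * t) * (1 + t) powr (n - 1))
      = (LBINT t:{0..}. erlang_kernel (n + 1) l t - erlang_kernel n l t)"
    by (intro set_lebesgue_integral_cong) (auto simp: erlang_kernel_def powr_diff field_simps)
  also have "\<dots> = erlang_J (n + 1) l - erlang_J n l"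
    unfolding erlang_J_def by (intro set_integral_diff(2) set_integrable_erlang_kernel l)
  finally have "l * (LBINT t:{0..}. t * exp (- l * t) * (1 + t) powr (n - 1))
      = l * erlang_J (n + 1) l - l * erlang_J n l"
    by (simp only: right_diff_distrib)
  hence "l * (LBINT t:{0..}. t * exp (- l * t) * (1 + t) powr (n - 1)) = 1 + (n - l) * erlang_J n l"
    unfolding erlang_J_recurrence[OF l] by (simp only: algebra_simps)
  thus ?thesis by (simp add: erlang_c_def)
qed

section \<open>The logarithmic gap \<open>x - 1 - ln x\<close> and its signed square root\<close>

lemma rational_le_log_gap:
  fixes x :: real
  assumes "0 < x"
  shows "9 * (x - 1)\<^sup>2 / (2 * (x + 2)\<^sup>2) \<le> x - 1 - ln x"
proof -
  \<comment> \<open>The rational function matches the gap to third order at 1. The derivative of the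
    difference has the sign of \<open>x - 1\<close>, so 1 is a minimum, with value 0.\<close>
  let ?h = "\<lambda>x. x - 1 - ln x - 9 * (x - 1)\<^sup>2 / (2 * (x + 2)\<^sup>2)"
  let ?h' = "\<lambda>x. (x - 1) * (1 / x - 27 / (x + 2) ^ 3)"
  have D: "(?h has_real_derivative ?h' y) (at y)" if "0 < y" for y
  proof -
    have [simp]: "y + 2 \<noteq> 0" using that by simp
    have "(?h has_real_derivative (1 - 1 / y
        - (18 * (y - 1) * (2 * (y + 2)\<^sup>2) - 9 * (y - 1)\<^sup>2 * (4 * (y + 2))) / (2 * (y + 2)\<^sup>2)\<^sup>2)) (at y)"
      using that by (auto intro!: derivative_eq_intros simp: power2_eq_square)
    moreover have "1 - 1 / y
        - (18 * (y - 1) * (2 * (y + 2)\<^sup>2) - 9 * (y - 1)\<^sup>2 * (4 * (y + 2))) / (2 * (y + 2)\<^sup>2)\<^sup>2 = ?h' y"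
      using that by (simp add: divide_simps) algebra
    ultimately show ?thesis by simp
  qed
  \<comment> \<open>This is the arithmetic-geometric mean inequality for \<open>y\<close>, 1 and
    1.\<close>
  have pos: "0 \<le> 1 / y - 27 / (y + 2) ^ 3" if "0 < y" for y :: real
  proof -
    have "0 \<le> (y - 1)\<^sup>2 * (y + 8)" using that by simp
    also have "\<dots> = (y + 2) ^ 3 - 27 * y" by algebra
    finally show ?thesis using that by (simp add: field_simps)
  qed
  have "?h 1 \<le> ?h x"
  proof (cases "1 \<le> x")
    case True
    show ?thesis
    proof (rule DERIV_nonneg_imp_nondecreasing[where f="?h", OF True], intro exI conjI)
      fix y assume "1 \<le> y" "y \<le> x"
      thus "(?h has_real_derivative ?h' y) (at y)" "0 \<le> ?h' y"
        using D[of y] pos[of y] by auto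
    qed
  next
    case False
    hence "x \<le> 1" by simp
    show ?thesis
    proof (rule DERIV_nonpos_imp_nonincreasing[where f="?h", OF \<open>x \<le> 1\<close>], intro exI conjI)
      fix y assume "x \<le> y" "y \<le> 1"
      thus "(?h has_real_derivative ?h' y) (at y)" "?h' y \<le> 0"
        using D[of y] pos[of y] assms by (auto intro: mult_nonpos_nonneg)
    qed
  qed
  thus ?thesis by simp
qed

text \<open>The sign follows \<open>x - 1\<close>, so that one Gaussian substitution covers both
  sides of the minimum of the gap at 1.\<close>

definition gap_root :: "real \<Rightarrow> real" where
  "gap_root x = (if 1 \<le> x then sqrt (2 * (x - 1 - ln x)) else - sqrt (2 * (x - 1 - ln x)))"

lemma log_gap_nonneg: "0 < x \<Longrightarrow> 0 \<le> x - 1 - ln (x::real)"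
  using ln_le_minus_one[of x] by simp

lemma gap_root_power2: "0 < x \<Longrightarrow> (gap_root x)\<^sup>2 = 2 * (x - 1 - ln x)"
  using log_gap_nonneg[of x] by (simp add: gap_root_def)

lemma gap_root_le_rational:
  assumes "0 < x" "x \<noteq> 1"
  shows "3 * \<bar>x - 1\<bar> / (x + 2) \<le> \<bar>gap_root x\<bar>"
proof (rule power2_le_imp_le)
  have "(3 * \<bar>x - 1\<bar> / (x + 2))\<^sup>2 = 2 * (9 * (x - 1)\<^sup>2 / (2 * (x + 2)\<^sup>2))"
    by (simp add: power_divide power_mult_distrib)
  also have "\<dots> \<le> \<bar>gap_root x\<bar>\<^sup>2"
    using rational_le_log_gap[OF assms(1)] gap_root_power2[OF assms(1)] by simp
  finally show "(3 * \<bar>x - 1\<bar> / (x + 2))\<^sup>2 \<le> \<bar>gap_root x\<bar>\<^sup>2" .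
qed simp

lemma gap_root_neq_0: "0 < x \<Longrightarrow> x \<noteq> 1 \<Longrightarrow> gap_root x \<noteq> 0"
  using gap_root_le_rational[of x] by (auto simp: field_simps)

text \<open>The differential inequality for the substitution, multiplied by \<open>x\<close>.
  Clearing denominators turns it into the rational bound; for \<open>x < 1\<close> both
  \<open>x - 1\<close> and \<open>gap_root x\<close> are negative.\<close>

lemma gap_root_slope_bound:
  assumes "0 < x" "x \<noteq> 1"
  shows "(1 - gap_root x / 3) * ((x - 1) / gap_root x) \<le> 1"
proof (cases "1 \<le> x")
  case True
  hence w: "0 < gap_root x" using gap_root_neq_0[OF assms] log_gap_nonneg[OF assms(1)]
    by (simp add: gap_root_def)
  hence "3 * (x - 1) \<le> gap_root x * (x + 2)"
    using gap_root_le_rational[OF assms] True by (simp add: field_simps)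
  thus ?thesis using w by (simp add: field_simps)
next
  case False
  hence w: "gap_root x < 0" using gap_root_neq_0[OF assms] log_gap_nonneg[OF assms(1)]
    by (simp add: gap_root_def)
  hence "3 * (1 - x) \<le> - gap_root x * (x + 2)"
    using gap_root_le_rational[OF assms] False assms(1) by (simp add: field_simps)
  thus ?thesis using w by (simp add: field_simps)
qed

text \<open>Implicit differentiation of the equation for the squared root. At \<open>x = 1\<close>
  the quotient degenerates to 0/0, hence the exclusion.\<close>

lemma DERIV_gap_root:
  assumes "0 < x" "x \<noteq> 1"
  shows "(gap_root has_real_derivative (x - 1) / (x * gap_root x)) (at x)"
proof -
  have pos: "0 < x - 1 - ln x"
    using gap_root_power2[OF assms(1)] gap_root_neq_0[OF assms] log_gap_nonneg[OF assms(1)]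
    by (metis less_eq_real_def mult_zero_right zero_eq_power2)
  have D: "((\<lambda>x. sqrt (2 * (x - 1 - ln x))) has_real_derivative
      (x - 1) / (x * sqrt (2 * (x - 1 - ln x)))) (at x)"
    using assms pos by (auto intro!: derivative_eq_intros simp: field_simps)
  show ?thesis
  proof (cases "1 < x")
    case True
    show ?thesis
      by (rule has_field_derivative_transform_within_open[where S="{1<..}"])
        (use D True in \<open>auto simp: gap_root_def\<close>)
  next
    case False
    show ?thesis
      by (rule has_field_derivative_transform_within_open[where S="{..<1}", OF DERIV_minus[OF D, THEN DERIV_cong]])
        (use False assms in \<open>auto simp: gap_root_def\<close>)
  qed
qed

text \<open>Both branches vanish at 1. Continuity there lets a primitive built from
  \<open>gap_root\<close> cross the point excluded from the derivative formula.\<close>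

lemma continuous_on_gap_root: "continuous_on {0<..} gap_root"
proof -
  have "continuous_on ({1..} \<union> {0<..1}) gap_root"
    unfolding gap_root_def
  proof (rule continuous_on_cases_local)
    show "closedin (top_of_set ({1..} \<union> {0<..1})) {1::real..}"
      by (auto simp: closedin_closed intro!: exI[of _ "{1..}"])
    show "closedin (top_of_set ({1..} \<union> {0<..1})) {0<..1::real}"
      by (auto simp: closedin_closed intro!: exI[of _ "{..1}"])
  qed (auto intro!: continuous_intros simp: antisym)
  also have "{1..} \<union> {0<..1} = {0::real<..}" by auto
  finally show ?thesis .
qed

lemma gap_root_at_top: "filterlim gap_root at_top at_top"
proof -
  have "filterlim (\<lambda>x::real. sqrt (2 * (x - 1 - ln x))) at_top at_top"
    by real_asymp
  thus ?thesis
    by (rule filterlim_mono_eventually[OF _ order_refl order_refl])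
      (auto simp: gap_root_def intro: eventually_mono[OF eventually_ge_at_top[of 1]])
qed

section \<open>The Gaussian lower bound for the Erlang integral\<close>

lemma DERIV_std_phi: "(std_phi has_real_derivative - x * std_phi x) (at x)"
proof -
  have "((\<lambda>x. exp (- (x ^ 2) / 2)) has_real_derivative - x * exp (- (x ^ 2) / 2)) (at x)"
    by (auto intro!: derivative_eq_intros)
  from DERIV_cdivide[OF this, of "sqrt (2 * pi)"] show ?thesis
    by (simp add: std_phi_def[abs_def])
qed

lemma std_phi_at_top: "(std_phi \<longlongrightarrow> 0) at_top"
  unfolding std_phi_def[abs_def] by real_asymp

lemma erlang_J_ge:
  assumes l: "0 < l" "l \<le> n"
  defines "a \<equiv> sqrt (- 2 * n * (1 - l / n + ln (l / n)))"
  shows "mills a / sqrt n - 1 / (3 * n) \<le> erlang_J n l"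
proof -
  define r where "r = l / n"
  have n: "0 < n" and r: "0 < r" "r \<le> 1" and lr: "l = n * r"
    using l by (auto simp: r_def)
  define x where "x t = r * (1 + t)" for t
  define w where "w t = gap_root (x t)" for t
  have x: "0 < x t" if "0 \<le> t" for t using r that by (simp add: x_def)
  \<comment> \<open>Since \<open>r \<le> 1\<close>, the substitution starts on the negative branch,
    at \<open>sqrt n * w 0 = - a\<close>.\<close>
  have a: "a = - sqrt n * gap_root r"
  proof -
    have "a = sqrt (n * (2 * (r - 1 - ln r)))"
      by (simp add: a_def r_def[symmetric] algebra_simps)
    also have "\<dots> = sqrt n * sqrt (2 * (r - 1 - ln r))" by (rule real_sqrt_mult)
    also have "sqrt (2 * (r - 1 - ln r)) = - gap_root r"
      using r by (cases "r = 1") (auto simp: gap_root_def)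
    finally show ?thesis by simp
  qed
  \<comment> \<open>No loss occurs here: \<open>- l * t + n * ln (1 + t)\<close> is exactly
    \<open>n\<close> times the gap at \<open>r\<close> minus the gap at \<open>x t\<close>.\<close>
  have kernel: "erlang_kernel n l t = std_phi (sqrt n * w t) / std_phi a / (1 + t)" if "0 \<le> t" for t
  proof -
    have "std_phi (sqrt n * w t) / std_phi a = exp (a\<^sup>2 / 2 - (sqrt n * w t)\<^sup>2 / 2)"
      by (rule std_phi_divide)
    also have "a\<^sup>2 / 2 - (sqrt n * w t)\<^sup>2 / 2 = - l * t + n * ln (1 + t)"
    proof -
      have "a\<^sup>2 / 2 - (sqrt n * w t)\<^sup>2 / 2 = n * ((gap_root r)\<^sup>2 - (w t)\<^sup>2) / 2"
        using n by (simp add: a power_mult_distrib algebra_simps diff_divide_distrib)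
      also have "(gap_root r)\<^sup>2 - (w t)\<^sup>2 = 2 * (ln (1 + t) - r * t)"
      proof -
        have "ln (x t) = ln r + ln (1 + t)"
          unfolding x_def using r that by (intro ln_mult_pos) auto
        moreover have "x t = r + r * t" by (simp add: x_def algebra_simps)
        ultimately show ?thesis
          unfolding w_def gap_root_power2[OF r(1)] gap_root_power2[OF x[OF that]] by argo
      qed
      finally show ?thesis by (simp add: lr algebra_simps)
    qed
    also have "exp \<dots> = exp (- l * t) * (1 + t) powr n"
      using that by (simp add: powr_def flip: exp_add)
    finally show ?thesis using that by (simp add: erlang_kernel_def powr_diff)
  qed
  \<comment> \<open>A primitive of the Gaussian times \<open>1 - w / 3\<close>: the linear term
    integrates to the density, whose derivative is \<open>- x * std_phi x\<close>.\<close>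
  let ?Q = "\<lambda>t. (std_Phi (sqrt n * w t) / sqrt n + std_phi (sqrt n * w t) / (3 * n)) / std_phi a"
  let ?w' = "\<lambda>t. (x t - 1) / (x t * w t) * r"
  let ?q = "\<lambda>t. std_phi (sqrt n * w t) / std_phi a * (?w' t * (1 - w t / 3))"
  \<comment> \<open>The only \<open>t\<close> with \<open>x t = 1\<close>.\<close>
  let ?S = "{1 / r - 1}"
  have x1: "x t \<noteq> 1" if "t \<notin> ?S" for t
    using that r by (auto simp: x_def field_simps)
  have "1 / (sqrt n * std_phi a) - ?Q 0 \<le> (LBINT t:{0..}. erlang_kernel n l t)"
  proof (rule set_integral_FTC_bound_below[where S="?S" and q="?q"])
    show "set_integrable lborel {0..} (erlang_kernel n l)"
      by (rule set_integrable_erlang_kernel[OF l(1)])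
    fix t assume t: "0 < t" "t \<notin> ?S"
    have "(w has_real_derivative ?w' t) (at t)"
      unfolding w_def by (rule DERIV_chain2[OF DERIV_gap_root])
        (use x[of t] x1[of t] t in \<open>auto simp: x_def intro!: derivative_eq_intros\<close>)
    hence sw: "((\<lambda>t. sqrt n * w t) has_real_derivative sqrt n * ?w' t) (at t)"
      by (rule DERIV_cmult)
    have "(?Q has_real_derivative (std_phi (sqrt n * w t) * (sqrt n * ?w' t) / sqrt n
        + (- (sqrt n * w t) * std_phi (sqrt n * w t) * (sqrt n * ?w' t)) / (3 * n)) / std_phi a) (at t)"
      by (intro DERIV_cdivide DERIV_add DERIV_chain2[OF DERIV_std_Phi sw] DERIV_chain2[OF DERIV_std_phi sw])
    also have "(std_phi (sqrt n * w t) * (sqrt n * ?w' t) / sqrt n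
        + (- (sqrt n * w t) * std_phi (sqrt n * w t) * (sqrt n * ?w' t)) / (3 * n)) / std_phi a = ?q t"
    proof -
      have eq: "(p * (k * v) / k + (- (k * u) * p * (k * v)) / (3 * q)) / m = p / m * (v * (1 - u / 3))"
        if "q = k * k" "k \<noteq> 0" "m \<noteq> 0" for p k q v u m :: real
        unfolding that(1) using that(2,3) by (simp add: field_simps)
      show ?thesis
        by (rule eq) (use n std_phi_pos[of a] in auto)
    qed
    finally show "(?Q has_real_derivative ?q t) (at t)" .
    have "?w' t * (1 - w t / 3) = (1 - w t / 3) * ((x t - 1) / w t) * (1 / (1 + t))"
      using t r by (simp add: x_def mult.commute)
    also have "\<dots> \<le> 1 * (1 / (1 + t))"
      unfolding w_def by (rule mult_right_mono[OF gap_root_slope_bound]) (use x[of t] x1[of t] t in auto)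
    finally have "?q t \<le> std_phi (sqrt n * w t) / std_phi a * (1 / (1 + t))"
      using std_phi_pos[of a] std_phi_pos[of "sqrt n * w t"] by (intro mult_left_mono) auto
    thus "?q t \<le> erlang_kernel n l t"
      using kernel[of t] t by simp
  next
    show "continuous_on {0..} ?Q"
      unfolding w_def using std_phi_pos[of a] n r
      by (intro continuous_intros continuous_on_compose2[OF continuous_on_gap_root])
        (auto simp: x_def intro!: continuous_intros)
    have "filterlim x at_top at_top"
      unfolding x_def[abs_def] using r by real_asymp
    hence "filterlim w at_top at_top"
      unfolding w_def[abs_def] by (rule filterlim_compose[OF gap_root_at_top])
    hence "filterlim (\<lambda>t. sqrt n * w t) at_top at_top"
      using n by (intro filterlim_tendsto_pos_mult_at_top[OF tendsto_const]) auto
    hence "(?Q \<longlongrightarrow> (1 / sqrt n + 0 / (3 * n)) / std_phi a) at_top"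
      by (intro tendsto_divide tendsto_add tendsto_const filterlim_compose[OF std_Phi_at_top]
          filterlim_compose[OF std_phi_at_top]) (use n std_phi_pos[of a] in auto)
    thus "(?Q \<longlongrightarrow> 1 / (sqrt n * std_phi a)) at_top" by simp
  qed simp
  also have "1 / (sqrt n * std_phi a) - ?Q 0 = mills a / sqrt n - 1 / (3 * n)"
  proof -
    have "sqrt n * w 0 = - a" by (simp add: w_def x_def a)
    thus ?thesis using std_phi_pos[of a] n
      by (simp add: mills_def std_Phi_minus field_simps)
  qed
  finally show ?thesis by (simp add: erlang_J_def)
qed

section \<open>Reciprocals of the delay probability, its bound and its limit\<close>

lemma continuous_on_mills [continuous_intros]:
  assumes "continuous_on S f"
  shows "continuous_on S (\<lambda>x. mills (f x))"
  unfolding mills_def using assms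
  by (intro continuous_intros) (auto simp: less_imp_neq[OF std_phi_pos, symmetric])

lemma mills_pos: "0 \<le> x \<Longrightarrow> 0 < mills x"
  by (simp add: mills_def std_Phi_pos std_phi_pos)

lemma mills_mono: "0 \<le> x \<Longrightarrow> x \<le> y \<Longrightarrow> mills x \<le> mills y"
  unfolding mills_def
  by (intro frac_le std_Phi_nonneg std_Phi_mono std_phi_pos std_phi_antimono)

text \<open>Dominated convergence: a convergent sequence of exponents is bounded by some
  \<open>K\<close>, and as \<open>1 + t \<ge> 1\<close> the kernel with parameter \<open>K\<close>
  dominates.\<close>

lemma continuous_on_erlang_J:
  assumes l: "0 < l"
  shows "continuous_on UNIV (\<lambda>n. erlang_J n l)"
  unfolding continuous_on_sequentially o_def
proof clarify
  fix X :: "nat \<Rightarrow> real" and n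
  assume X: "X \<longlonglongrightarrow> n"
  from convergent_imp_Bseq[OF convergentI[OF X]] obtain K where K: "\<And>i. \<bar>X i\<bar> \<le> K"
    by (auto simp: Bseq_def)
  show "(\<lambda>i. erlang_J (X i) l) \<longlonglongrightarrow> erlang_J n l"
    unfolding erlang_J_def set_lebesgue_integral_def
  proof (rule integral_dominated_convergence)
    show "integrable lborel (\<lambda>t. indicator {0..} t *\<^sub>R erlang_kernel K l t)"
      using set_integrable_erlang_kernel[OF l] by (simp add: set_integrable_def)
    show "AE t in lborel. (\<lambda>i. indicator {0..} t *\<^sub>R erlang_kernel (X i) l t)
        \<longlonglongrightarrow> indicator {0..} t *\<^sub>R erlang_kernel n l t"
      using X by (auto simp: erlang_kernel_def indicator_def intro!: tendsto_intros AE_I2)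
    show "AE t in lborel. norm (indicator {0..} t *\<^sub>R erlang_kernel (X i) l t)
        \<le> indicator {0..} t *\<^sub>R erlang_kernel K l t" for i
      using K[of i] by (auto simp: erlang_kernel_def indicator_def intro!: AE_I2 powr_mono)
  qed measurable
qed

text \<open>The reciprocal before capping at 1, with \<open>n - l\<close> written as
  \<open>b * sqrt l\<close>.\<close>

definition erlang_inv :: "real \<Rightarrow> real \<Rightarrow> real" where
  "erlang_inv l b = 1 + b * sqrt l * erlang_J (l + b * sqrt l) l"

definition bound_inv :: "real \<Rightarrow> real \<Rightarrow> real" where
  "bound_inv l b = (let n = l + b * sqrt l; r = l / n in
     r + (n - l) / sqrt n * (mills (sqrt (- 2 * n * (1 - r + ln r))) + 2 / (3 * sqrt n)))"

definition limit_inv :: "real \<Rightarrow> real" where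
  "limit_inv b = 1 + b * mills b"

text \<open>The cap at 1 cannot make the constraint hold, because \<open>e < 1\<close>.\<close>

lemma alpha_tilde_le_iff:
  assumes "0 < l" "0 \<le> b" "0 < e" "e < 1"
  shows "alpha_tilde b l \<le> e \<longleftrightarrow> 1 / e \<le> erlang_inv l b"
proof -
  have "0 < erlang_inv l b"
    using assms erlang_J_nonneg by (auto simp: erlang_inv_def intro: add_pos_nonneg)
  moreover have "alpha_tilde b l = min 1 (inverse (erlang_inv l b))"
    unfolding alpha_tilde_def erlang_c_eq[OF assms(1)] by (simp add: erlang_inv_def)
  ultimately show ?thesis using assms by (auto simp: min_le_iff_disj field_simps)
qed

lemma UB_le_iff:
  assumes "0 < l" "0 \<le> b" "0 < e"
  shows "UB b l \<le> e \<longleftrightarrow> 1 / e \<le> bound_inv l b"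
proof -
  have n: "0 < l + b * sqrt l" using assms by (auto intro: add_pos_nonneg)
  have "0 \<le> mills x" for x
    by (simp add: mills_def std_Phi_nonneg less_imp_le[OF std_phi_pos])
  hence "0 < bound_inv l b"
    using assms n unfolding bound_inv_def Let_def
    by (intro add_pos_nonneg mult_nonneg_nonneg add_nonneg_nonneg divide_pos_pos divide_nonneg_nonneg) auto
  moreover have "UB b l = inverse (bound_inv l b)"
    by (simp add: UB_def bound_inv_def Let_def mills_def)
  ultimately show ?thesis
    using assms by (simp add: inverse_eq_divide pos_divide_le_eq mult.commute)
qed

lemma bound_inv_le_erlang_inv:
  assumes "0 < l" "0 \<le> b"
  shows "bound_inv l b \<le> erlang_inv l b"
proof -
  define n where "n = l + b * sqrt l"
  have n: "0 < n" "l \<le> n" using assms by (auto simp: n_def intro: add_pos_nonneg)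
  define m where "m = mills (sqrt (- 2 * n * (1 - l / n + ln (l / n))))"
  have sq: "sqrt n * sqrt n = n" using n by simp
  have "bound_inv l b = l / n + (n - l) / sqrt n * (m + 2 / (3 * sqrt n))"
    by (simp add: bound_inv_def Let_def n_def[symmetric] m_def)
  also have "\<dots> = l / n + (n - l) * (m / sqrt n + 2 / (3 * (sqrt n * sqrt n)))"
    by (simp add: algebra_simps)
  \<comment> \<open>As \<open>l / n = 1 - (n - l) / n\<close>, the coefficients of
    \<open>(n - l) / n\<close> add up to \<open>2/3 - 1 = - 1/3\<close>, the constant in
    \<open>erlang_J_ge\<close>.\<close>
  also have "\<dots> = 1 + (n - l) * (m / sqrt n - 1 / (3 * n))"
    unfolding sq using n(1) by (simp add: field_simps)
  also have "\<dots> \<le> 1 + (n - l) * erlang_J n l"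
    using erlang_J_ge[OF assms(1) n(2)] n(2) unfolding m_def
    by (intro add_left_mono mult_left_mono) auto
  finally show ?thesis by (simp add: erlang_inv_def n_def)
qed

lemma erlang_inv_le_limit_inv:
  assumes "0 < l" "0 \<le> b"
  shows "erlang_inv l b \<le> limit_inv b"
proof -
  have "b * sqrt l * erlang_J (l + b * sqrt l) l \<le> b * sqrt l * (mills b / sqrt l)"
    using assms by (intro mult_left_mono erlang_J_le) auto
  thus ?thesis using assms by (simp add: erlang_inv_def limit_inv_def)
qed

lemma continuous_on_erlang_inv:
  assumes "0 < l"
  shows "continuous_on {0..} (erlang_inv l)"
  unfolding erlang_inv_def
  by (intro continuous_intros continuous_on_compose2[OF continuous_on_erlang_J[OF assms]]) auto

lemma continuous_on_bound_inv:
  assumes "0 < l"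
  shows "continuous_on {0..} (bound_inv l)"
proof -
  have "0 < l + b * sqrt l" if "0 \<le> b" for b
    using assms that by (auto intro: add_pos_nonneg)
  thus ?thesis
    unfolding bound_inv_def Let_def using assms
    by (intro continuous_intros) (auto simp: less_imp_neq[symmetric])
qed

text \<open>Supplies a feasible point for each \<open>l\<close>: the ratio \<open>mills\<close>
  stays above \<open>mills 0\<close>, while its prefactor grows like the square root of
  \<open>b\<close>.\<close>

lemma bound_inv_at_top:
  assumes "0 < l"
  shows "filterlim (bound_inv l) at_top at_top"
proof (rule filterlim_at_top_mono)
  show "filterlim (\<lambda>b. b * sqrt l / sqrt (l + b * sqrt l) * mills 0) at_top at_top"
  proof (rule filterlim_at_top_mult_tendsto_pos[OF tendsto_const])
    show "filterlim (\<lambda>b. b * sqrt l / sqrt (l + b * sqrt l)) at_top at_top"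
      using assms by real_asymp
  qed (use mills_pos[of 0] in simp)
  show "\<forall>\<^sub>F b in at_top. b * sqrt l / sqrt (l + b * sqrt l) * mills 0 \<le> bound_inv l b"
  proof (rule eventually_mono[OF eventually_ge_at_top[of 0]])
    fix b :: real assume b: "0 \<le> b"
    define n where "n = l + b * sqrt l"
    have n: "0 < n" "l \<le> n" using assms b by (auto simp: n_def intro: add_pos_nonneg)
    have "0 \<le> - 2 * n * (1 - l / n + ln (l / n))"
      using n assms log_gap_nonneg[of "l / n"] by (intro mult_nonpos_nonpos) auto
    hence "mills 0 \<le> mills (sqrt (- 2 * n * (1 - l / n + ln (l / n)))) + 2 / (3 * sqrt n)"
      using n by (intro add_increasing2 mills_mono) auto
    hence "(n - l) / sqrt n * mills 0
        \<le> (n - l) / sqrt n * (mills (sqrt (- 2 * n * (1 - l / n + ln (l / n)))) + 2 / (3 * sqrt n))"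
      using n by (intro mult_left_mono) auto
    also have "\<dots> \<le> bound_inv l b"
      using n assms by (simp add: bound_inv_def Let_def n_def[symmetric])
    finally show "b * sqrt l / sqrt (l + b * sqrt l) * mills 0 \<le> bound_inv l b"
      by (simp add: n_def)
  qed
qed

lemma bound_inv_tendsto:
  assumes "0 < b"
  shows "((\<lambda>l. bound_inv l b) \<longlongrightarrow> limit_inv b) at_top"
proof -
  have r: "((\<lambda>l. l / (l + b * sqrt l)) \<longlongrightarrow> 1) at_top"
    using assms by real_asymp
  have g: "((\<lambda>l. ((l + b * sqrt l) - l) / sqrt (l + b * sqrt l)) \<longlongrightarrow> b) at_top"
    using assms by real_asymp
  have s: "((\<lambda>l. 2 / (3 * sqrt (l + b * sqrt l))) \<longlongrightarrow> 0) at_top"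
    using assms by real_asymp
  let ?a = "((\<lambda>l. sqrt (- 2 * (l + b * sqrt l) * (1 - l / (l + b * sqrt l) + ln (l / (l + b * sqrt l))))) \<longlongrightarrow> b) at_top"
  \<comment> \<open>To leading order the radicand is
    \<open>n * (1 - l / n)\<^sup>2 = b\<^sup>2 * l / n\<close>, which tends to
    \<open>b\<^sup>2\<close>.\<close>
  have "((\<lambda>l. sqrt (- 2 * (l + b * sqrt l) * (1 - l / (l + b * sqrt l) + ln (l / (l + b * sqrt l))))) \<longlongrightarrow> sqrt (b * b)) at_top"
    using assms by (intro tendsto_real_sqrt) real_asymp
  hence a: ?a using assms by simp
  have m: "isCont mills b"
    using continuous_on_mills[OF continuous_on_id[of UNIV]]
    by (auto simp: continuous_on_eq_continuous_at)
  have "((\<lambda>l. bound_inv l b) \<longlongrightarrow> 1 + b * (mills b + 0)) at_top"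
    unfolding bound_inv_def Let_def
    by (intro tendsto_add tendsto_mult r g s isCont_tendsto_compose[OF m a])
  thus ?thesis by (simp add: limit_inv_def)
qed

lemma limit_inv_strict_mono:
  assumes "0 \<le> x" "x < y"
  shows "limit_inv x < limit_inv y"
proof -
  have "x * mills x < y * mills y"
    using assms mills_pos[of x] mills_pos[of y] mills_mono[of x y]
    by (intro mult_less_le_imp_less) auto
  thus ?thesis by (simp add: limit_inv_def)
qed

lemma limit_inv_surj:
  assumes "1 < y"
  obtains b where "0 < b" "limit_inv b = y"
proof -
  \<comment> \<open>At this point \<open>limit_inv\<close> is at least
    \<open>1 + ?B * mills 0 = 1 + y\<close>.\<close>
  let ?B = "y / mills 0"
  have cont: "continuous_on {0..?B} limit_inv"
    unfolding limit_inv_def[abs_def] by (intro continuous_intros)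
  have B: "0 \<le> ?B" using assms mills_pos[of 0] by simp
  have "y \<le> limit_inv ?B"
    using mult_left_mono[OF mills_mono[OF order_refl B] B] mills_pos[of 0] by (simp add: limit_inv_def)
  then obtain b where b: "0 \<le> b" "limit_inv b = y"
    using IVT'[of limit_inv 0 y ?B, OF _ _ B cont] assms
    by (auto simp: limit_inv_def)
  thus ?thesis using assms that[of b] by (cases "b = 0") (auto simp: limit_inv_def)
qed

section \<open>Optimal solutions as least feasible points, and their limits\<close>

lemma is_opt_iff:
  assumes "strict_mono_on {0..} c"
  shows "is_opt P c b \<longleftrightarrow> 0 \<le> b \<and> P b \<and> (\<forall>b'. 0 \<le> b' \<and> P b' \<longrightarrow> b \<le> b')"
  using strict_mono_on_less_eq[OF assms] by (auto simp: is_opt_def)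

text \<open>The feasible set is a closed preimage, bounded below by 0 and nonempty, so it contains
  its infimum.\<close>

lemma ex1_is_opt:
  fixes f :: "real \<Rightarrow> real"
  assumes c: "strict_mono_on {0..} c" and f: "continuous_on {0..} f"
    and P: "\<And>b. 0 \<le> b \<Longrightarrow> P b \<longleftrightarrow> y \<le> f b" and ne: "0 \<le> b0" "P b0"
  shows "\<exists>!b. is_opt P c b"
proof -
  let ?S = "{0..} \<inter> f -` {y..}"
  have "closed ?S"
    by (intro continuous_closed_preimage f) auto
  moreover have "b0 \<in> ?S" using ne P by auto
  moreover have bdd: "bdd_below ?S" by (auto intro: bdd_belowI[of _ 0])
  ultimately have "Inf ?S \<in> ?S"
    by (intro closed_contains_Inf) auto
  hence "is_opt P c (Inf ?S)"
    unfolding is_opt_iff[OF c] using P bdd by (auto intro: cInf_lower)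
  thus ?thesis
    by (metis is_opt_iff[OF c] order_antisym)
qed

theorem theorem4:
  fixes c :: "real \<Rightarrow> real" and \<epsilon> :: real
  assumes "continuous_on {0..} c"
    and "strict_mono_on {0..} c"
    and "0 < \<epsilon>" and "\<epsilon> < 1"
  shows "(\<forall>lam > 0. (\<exists>!\<beta>. is_opt (\<lambda>b. alpha_tilde b lam \<le> \<epsilon>) c \<beta>)
                 \<and> (\<exists>!\<beta>. is_opt (\<lambda>b. UB b lam \<le> \<epsilon>) c \<beta>)
                 \<and> betaF c \<epsilon> lam \<le> betaG c \<epsilon> lam)
       \<and> (\<exists>\<beta>star :: real. ((betaG c \<epsilon>) \<longlongrightarrow> \<beta>star) at_top
                         \<and> ((betaF c \<epsilon>) \<longlongrightarrow> \<beta>star) at_top)"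
proof -
  note c = assms(2) and e = assms(3,4)
  let ?F = "\<lambda>l b. alpha_tilde b l \<le> \<epsilon>" and ?G = "\<lambda>l b. UB b l \<le> \<epsilon>"
  note F = alpha_tilde_le_iff[OF _ _ e] and G = UB_le_iff[OF _ _ e(1)]
  have G_F: "?F l b" if "0 < l" "0 \<le> b" "?G l b" for l b
    using that bound_inv_le_erlang_inv[of l b] by (simp add: F G)
  have ex: "(\<exists>!b. is_opt (?F l) c b) \<and> (\<exists>!b. is_opt (?G l) c b)" if l: "0 < l" for l
  proof -
    have "\<forall>\<^sub>F b in at_top. 0 \<le> b \<and> 1 / \<epsilon> \<le> bound_inv l b"
      using bound_inv_at_top[OF l] by (intro eventually_conj eventually_ge_at_top) (simp add: filterlim_at_top)
    then obtain b where b: "0 \<le> b" "?G l b"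
      using G[OF l] eventually_happens'[OF trivial_limit_at_top_linorder] by blast
    show ?thesis
      using ex1_is_opt[OF c continuous_on_erlang_inv[OF l] F[OF l] b(1) G_F[OF l b]]
        ex1_is_opt[OF c continuous_on_bound_inv[OF l] G[OF l] b] by blast
  qed
  have optF: "is_opt (?F l) c (betaF c \<epsilon> l)" and optG: "is_opt (?G l) c (betaG c \<epsilon> l)" if "0 < l" for l
    unfolding betaF_def betaG_def using ex[OF that] by (blast intro: theI')+
  have le: "betaF c \<epsilon> l \<le> betaG c \<epsilon> l" if "0 < l" for l
    using optF[OF that] optG[OF that] G_F[OF that] unfolding is_opt_iff[OF c] by blast
  obtain s where s: "0 < s" "limit_inv s = 1 / \<epsilon>"
    using limit_inv_surj[of "1 / \<epsilon>"] e by auto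
  \<comment> \<open>To the left of \<open>s\<close> even the majorant \<open>limit_inv\<close> lies
    below \<open>1 / \<epsilon>\<close>, so no point there is feasible, whatever \<open>l\<close>
    is.\<close>
  have ge: "s \<le> betaF c \<epsilon> l" if l: "0 < l" for l
  proof (rule ccontr)
    let ?b = "betaF c \<epsilon> l"
    assume "\<not> s \<le> ?b"
    moreover have b: "0 \<le> ?b" "?F l ?b"
      using optF[OF l] by (auto simp: is_opt_def)
    ultimately show False
      using erlang_inv_le_limit_inv[OF l b(1)] limit_inv_strict_mono[of ?b s] s F[OF l b(1)] by simp
  qed
  \<comment> \<open>A fixed \<open>v\<close> strictly between \<open>s\<close> and \<open>u\<close>
    is eventually feasible, since \<open>bound_inv l v\<close> tends to \<open>limit_inv v\<close>,
    which exceeds \<open>1 / \<epsilon>\<close>.\<close>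
  have up: "\<forall>\<^sub>F l in at_top. betaG c \<epsilon> l < u" if u: "s < u" for u
  proof -
    obtain v where v: "s < v" "v < u" using dense[OF u] by blast
    have "1 / \<epsilon> < limit_inv v" using limit_inv_strict_mono[of s v] s v by simp
    hence "\<forall>\<^sub>F l in at_top. 1 / \<epsilon> < bound_inv l v"
      using s v by (intro order_tendstoD(1)[OF bound_inv_tendsto]) auto
    thus ?thesis
      using eventually_gt_at_top[of 0]
    proof eventually_elim
      case (elim l)
      hence "betaG c \<epsilon> l \<le> v"
        using optG[of l] G[of l v] s v by (auto simp: is_opt_iff[OF c])
      thus ?case using v by simp
    qed
  qed
  have limG: "(betaG c \<epsilon> \<longlongrightarrow> s) at_top"
  proof (rule order_tendstoI)
    fix u assume "u < s"
    thus "\<forall>\<^sub>F l in at_top. u < betaG c \<epsilon> l"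
      using ge le by (intro eventually_mono[OF eventually_gt_at_top[of 0]]) (meson less_le_trans)
  qed (rule up)
  moreover have "(betaF c \<epsilon> \<longlongrightarrow> s) at_top"
    by (rule tendsto_sandwich[OF _ _ tendsto_const limG];
        rule eventually_mono[OF eventually_gt_at_top[of 0]]) (fact ge le)+
  ultimately show ?thesis using ex le by blast
qed

end
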